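(* Let $X$ be a continuous (that is, d-continuous) QFS-space. Then the space $\mathcal{Q}_{fin}(X)$, endowed with the topology $\mathcal{O}_{\Rightarrow_{\mathcal{Q}}}(\mathcal{Q}_{fin}(X))$ (the upper powerspace of $X$), is an FS-space.
   Context: All topological spaces are $T_0$. For a space $(X,\tau)$, order-theoretic notions refer to the specialization order: $x\le y$ iff $x\in \mathrm{cl}_\tau\{y\}$. For $A\subseteq X$, $\uparrow A=\{x:\exists a\in A,\ a\le x\}$. A directed subset $D$ of $X$ (nonempty, every two elements have an upper bound in $D$), viewed as a net indexed by itself, converges to $x$, written $D\to_\tau x$ or $D\to x$, if it is eventually in every open neighbourhood of $x$. A set $U\subseteq X$ is directed open if for every directed $D$ and every $x\in U$ with $D\to_\tau x$ one has $D\cap U\neq\emptyset$; $d(X)$ is the family of directed open sets. $X$ is a directed space if $d(X)=\tau$. In a directed space $X$, $x\ll_d y$ means: for every directed $D\subseteq X$ with $D\to_\tau y$ there is $d\in D$ with $x\le d$. A directed space $X$ is d-continuous if for every $x\in X$ the set $\{y\in X:y\ll_d x\}$ is directed and converges to $x$. $\mathcal{P}^w(X)$ is the set of nonempty finite subsets of $X$. A nonempty family $\mathcal{F}\subseteq\mathcal{P}^w(X)$ is directed if for all $F_1,F_2\in\mathcal{F}$ there is $F\in\mathcal{F}$ with $F\subseteq\uparrow F_1\cap\uparrow F_2$; a directed family $\mathcal{F}$ converges to $x$, written $\mathcal{F}\to_\tau x$, if every open neighbourhood $U$ of $x$ contains some $F\in\mathcal{F}$ as a subset. For a directed space $X$,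 a map $\delta:X\to\mathcal{P}^w(X)$ is quasi-finitely separating if: (i) $a\le b$ implies $\delta(b)\subseteq\uparrow\delta(a)$; (ii) there is a finite set $F_\delta\subseteq X$ such that for every $x\in X$ there is $y\in F_\delta$ with $x\in\uparrow y\subseteq\uparrow\delta(x)$; (iii) for every directed $D\subseteq X$ with $D\to_\tau x$ and every open $U$ with $\delta(x)\subseteq U$, there is $d\in D$ with $\delta(d)\subseteq U$. A set $\mathcal{D}$ of maps $X\to\mathcal{P}^w(X)$ is directed if it is nonempty and for all $\delta_1,\delta_2\in\mathcal{D}$ there is $\delta\in\mathcal{D}$ with $\delta(x)\subseteq\uparrow\delta_1(x)\cap\uparrow\delta_2(x)$ for all $x\in X$. A quasi-approximate identity for $X$ is a directed set $\mathcal{D}$ of maps $X\to\mathcal{P}^w(X)$ such that for every $x\in X$, $\{\delta(x):\delta\in\mathcal{D}\}\to_\tau x$. A QFS-space is a directed space that has a quasi-approximate identity consisting of quasi-finitely separating maps. An approximate identity for a directed space $Z$ is a set $\mathcal{E}$ of continuous functions $Z\to Z$, directed in the pointwise order, such that for every $z\in Z$ the directed set $\{\delta(z):\delta\in\mathcal{E}\}$ converges to $z$. A continuous $\delta:Z\to Z$ is finitely separating if there is a finite set $F_\delta\subseteq Z$ such that for each $z\in Z$ there is $y\in F_\delta$ with $\delta(z)\le y\le z$. A directed space is finitely separated if it has an approximate identity consisting of finitely separating functions. A c-space is a space in which for every open $U$ and $x\in U$ there is $y\in U$ with $x\in(\uparrow y)^\circ$. An FS-space is a finitely separated directed space that is also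 a c-space. Upper powerspace: for a directed space $X$, $\mathcal{Q}_{fin}(X)=\{\uparrow F:F\in\mathcal{P}^w(X)\}$, ordered by $\uparrow F_1\le_{\mathcal{Q}}\uparrow F_2\iff\uparrow F_2\subseteq\uparrow F_1$. For a $\le_{\mathcal{Q}}$-directed $\mathcal{F}\subseteq\mathcal{Q}_{fin}(X)$ and $\uparrow H\in\mathcal{Q}_{fin}(X)$ with $H\in\mathcal{P}^w(X)$, $\mathcal{F}\Rightarrow_{\mathcal{Q}}\uparrow H$ means that there are finitely many directed sets $D_1,\dots,D_n\subseteq X$ such that: (1) $H\cap\{x:D_i\to x\}\ne\emptyset$ for each $i$; (2) every $h\in H$ satisfies $D_i\to h$ for some $i\in\{1,\dots,n\}$; (3) for every $(d_1,\dots,d_n)\in\prod_{i=1}^nD_i$ there is $\uparrow F\in\mathcal{F}$ with $\uparrow F\subseteq\bigcup_{i=1}^n\uparrow d_i$. A set $\mathcal{U}\subseteq\mathcal{Q}_{fin}(X)$ belongs to $\mathcal{O}_{\Rightarrow_{\mathcal{Q}}}(\mathcal{Q}_{fin}(X))$ iff for every directed $\mathcal{F}\subseteq\mathcal{Q}_{fin}(X)$ and every $\uparrow H$, $\mathcal{F}\Rightarrow_{\mathcal{Q}}\uparrow H\in\mathcal{U}$ implies $\mathcal{F}\cap\mathcal{U}\ne\emptyset$. It is known that this is a topology making $\mathcal{Q}_{fin}(X)$ a directed space whose specialization order is $\le_{\mathcal{Q}}$. *)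

theory Defs
  imports "HOL-Analysis.Analysis"
begin

section \<open>Specialization order and directed spaces\<close>

definition spec_le :: "'a topology \<Rightarrow> 'a \<Rightarrow> 'a \<Rightarrow> bool" where
  "spec_le X x y \<longleftrightarrow> x \<in> X closure_of {y}"

definition up :: "'a topology \<Rightarrow> 'a set \<Rightarrow> 'a set" where
  "up X A = {x \<in> topspace X. \<exists>a\<in>A. spec_le X a x}"

definition directed_in :: "'a topology \<Rightarrow> 'a set \<Rightarrow> bool" where
  "directed_in X D \<longleftrightarrow> D \<noteq> {} \<and> D \<subseteq> topspace X \<and>
     (\<forall>a\<in>D. \<forall>b\<in>D. \<exists>c\<in>D. spec_le X a c \<and> spec_le X b c)"

text \<open>Convergence of a directed set \<open>D\<close>, viewed as a net indexed by itself.\<close>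

definition dir_conv :: "'a topology \<Rightarrow> 'a set \<Rightarrow> 'a \<Rightarrow> bool" where
  "dir_conv X D x \<longleftrightarrow> x \<in> topspace X \<and>
     (\<forall>U. openin X U \<and> x \<in> U \<longrightarrow> (\<exists>d0\<in>D. \<forall>d\<in>D. spec_le X d0 d \<longrightarrow> d \<in> U))"

definition directed_open :: "'a topology \<Rightarrow> 'a set \<Rightarrow> bool" where
  "directed_open X U \<longleftrightarrow> U \<subseteq> topspace X \<and>
     (\<forall>D x. directed_in X D \<and> x \<in> U \<and> dir_conv X D x \<longrightarrow> D \<inter> U \<noteq> {})"

definition directed_space :: "'a topology \<Rightarrow> bool" where
  "directed_space X \<longleftrightarrow> t0_space X \<and> Collect (directed_open X) = Collect (openin X)"

definition way_below :: "'a topology \<Rightarrow> 'a \<Rightarrow> 'a \<Rightarrow> bool" where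
  "way_below X x y \<longleftrightarrow> x \<in> topspace X \<and> y \<in> topspace X \<and>
     (\<forall>D. directed_in X D \<and> dir_conv X D y \<longrightarrow> (\<exists>d\<in>D. spec_le X x d))"

definition d_continuous :: "'a topology \<Rightarrow> bool" where
  "d_continuous X \<longleftrightarrow> directed_space X \<and>
     (\<forall>x\<in>topspace X. directed_in X {y \<in> topspace X. way_below X y x} \<and>
        dir_conv X {y \<in> topspace X. way_below X y x} x)"


section \<open>QFS-spaces\<close>

definition Pw :: "'a topology \<Rightarrow> 'a set set" where
  "Pw X = {F. finite F \<and> F \<noteq> {} \<and> F \<subseteq> topspace X}"

definition directed_family :: "'a topology \<Rightarrow> 'a set set \<Rightarrow> bool" where
  "directed_family X \<F> \<longleftrightarrow> \<F> \<noteq> {} \<and> \<F> \<subseteq> Pw X \<and>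
     (\<forall>F1\<in>\<F>. \<forall>F2\<in>\<F>. \<exists>F\<in>\<F>. F \<subseteq> up X F1 \<inter> up X F2)"

definition family_conv :: "'a topology \<Rightarrow> 'a set set \<Rightarrow> 'a \<Rightarrow> bool" where
  "family_conv X \<F> x \<longleftrightarrow> x \<in> topspace X \<and>
     (\<forall>U. openin X U \<and> x \<in> U \<longrightarrow> (\<exists>F\<in>\<F>. F \<subseteq> U))"

text \<open>Maps on a space are total HOL functions of which only the values on \<open>topspace X\<close> matter.\<close>

definition quasi_finitely_separating :: "'a topology \<Rightarrow> ('a \<Rightarrow> 'a set) \<Rightarrow> bool" where
  "quasi_finitely_separating X \<delta> \<longleftrightarrow>
     \<delta> \<in> topspace X \<rightarrow> Pw X \<and>
     (\<forall>a\<in>topspace X. \<forall>b\<in>topspace X. spec_le X a b \<longrightarrow> \<delta> b \<subseteq> up X (\<delta> a)) \<and>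
     (\<exists>F. finite F \<and> F \<subseteq> topspace X \<and>
        (\<forall>x\<in>topspace X. \<exists>y\<in>F. x \<in> up X {y} \<and> up X {y} \<subseteq> up X (\<delta> x))) \<and>
     (\<forall>D x U. directed_in X D \<and> dir_conv X D x \<and> openin X U \<and> \<delta> x \<subseteq> U \<longrightarrow>
        (\<exists>d\<in>D. \<delta> d \<subseteq> U))"

definition directed_maps :: "'a topology \<Rightarrow> ('a \<Rightarrow> 'a set) set \<Rightarrow> bool" where
  "directed_maps X \<D> \<longleftrightarrow> \<D> \<noteq> {} \<and> \<D> \<subseteq> topspace X \<rightarrow> Pw X \<and>
     (\<forall>\<delta>1\<in>\<D>. \<forall>\<delta>2\<in>\<D>. \<exists>\<delta>\<in>\<D>. \<forall>x\<in>topspace X. \<delta> x \<subseteq> up X (\<delta>1 x) \<inter> up X (\<delta>2 x))"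

definition quasi_approximate_identity :: "'a topology \<Rightarrow> ('a \<Rightarrow> 'a set) set \<Rightarrow> bool" where
  "quasi_approximate_identity X \<D> \<longleftrightarrow> directed_maps X \<D> \<and>
     (\<forall>x\<in>topspace X. directed_family X ((\<lambda>\<delta>. \<delta> x) ` \<D>) \<and> family_conv X ((\<lambda>\<delta>. \<delta> x) ` \<D>) x)"

definition QFS_space :: "'a topology \<Rightarrow> bool" where
  "QFS_space X \<longleftrightarrow> directed_space X \<and>
     (\<exists>\<D>. quasi_approximate_identity X \<D> \<and> (\<forall>\<delta>\<in>\<D>. quasi_finitely_separating X \<delta>))"


section \<open>FS-spaces\<close>

definition approximate_identity :: "'a topology \<Rightarrow> ('a \<Rightarrow> 'a) set \<Rightarrow> bool" where
  "approximate_identity Z \<E> \<longleftrightarrow> \<E> \<noteq> {} \<and> (\<forall>\<delta>\<in>\<E>. continuous_map Z Z \<delta>) \<and>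
     (\<forall>\<delta>1\<in>\<E>. \<forall>\<delta>2\<in>\<E>. \<exists>\<delta>\<in>\<E>. \<forall>z\<in>topspace Z. spec_le Z (\<delta>1 z) (\<delta> z) \<and> spec_le Z (\<delta>2 z) (\<delta> z)) \<and>
     (\<forall>z\<in>topspace Z. directed_in Z ((\<lambda>\<delta>. \<delta> z) ` \<E>) \<and> dir_conv Z ((\<lambda>\<delta>. \<delta> z) ` \<E>) z)"

definition finitely_separating :: "'a topology \<Rightarrow> ('a \<Rightarrow> 'a) \<Rightarrow> bool" where
  "finitely_separating Z \<delta> \<longleftrightarrow> continuous_map Z Z \<delta> \<and>
     (\<exists>F. finite F \<and> F \<subseteq> topspace Z \<and>
        (\<forall>z\<in>topspace Z. \<exists>y\<in>F. spec_le Z (\<delta> z) y \<and> spec_le Z y z))"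

definition finitely_separated :: "'a topology \<Rightarrow> bool" where
  "finitely_separated Z \<longleftrightarrow> directed_space Z \<and>
     (\<exists>\<E>. approximate_identity Z \<E> \<and> (\<forall>\<delta>\<in>\<E>. finitely_separating Z \<delta>))"

definition c_space :: "'a topology \<Rightarrow> bool" where
  "c_space Z \<longleftrightarrow> t0_space Z \<and>
     (\<forall>U x. openin Z U \<and> x \<in> U \<longrightarrow> (\<exists>y\<in>U. x \<in> Z interior_of (up Z {y})))"

definition FS_space :: "'a topology \<Rightarrow> bool" where
  "FS_space Z \<longleftrightarrow> finitely_separated Z \<and> c_space Z"


section \<open>The upper powerspace\<close>

definition Qfin :: "'a topology \<Rightarrow> 'a set set" where
  "Qfin X = up X ` Pw X"

definition Q_le :: "'a set \<Rightarrow> 'a set \<Rightarrow> bool" where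
  "Q_le A B \<longleftrightarrow> B \<subseteq> A"

definition Q_directed :: "'a topology \<Rightarrow> 'a set set \<Rightarrow> bool" where
  "Q_directed X \<F> \<longleftrightarrow> \<F> \<noteq> {} \<and> \<F> \<subseteq> Qfin X \<and>
     (\<forall>A\<in>\<F>. \<forall>B\<in>\<F>. \<exists>C\<in>\<F>. Q_le A C \<and> Q_le B C)"

text \<open>\<open>Q_conv X \<F> H\<close> is the relation \<open>\<F> \<Rightarrow>\<^sub>Q \<up>H\<close>; its defining clauses refer to the
  finite set \<open>H\<close> presenting the element \<open>\<up>H\<close> of \<open>Qfin X\<close>.\<close>

definition Q_conv :: "'a topology \<Rightarrow> 'a set set \<Rightarrow> 'a set \<Rightarrow> bool" where
  "Q_conv X \<F> H \<longleftrightarrow>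
     (\<exists>(n::nat) D. (\<forall>i\<in>{1..n}. directed_in X (D i)) \<and>
        (\<forall>i\<in>{1..n}. H \<inter> {x. dir_conv X (D i) x} \<noteq> {}) \<and>
        (\<forall>h\<in>H. \<exists>i\<in>{1..n}. dir_conv X (D i) h) \<and>
        (\<forall>d \<in> Pi\<^sub>E {1..n} D. \<exists>A\<in>\<F>. A \<subseteq> (\<Union>i\<in>{1..n}. up X {d i})))"

definition Q_open :: "'a topology \<Rightarrow> 'a set set \<Rightarrow> bool" where
  "Q_open X \<U> \<longleftrightarrow> \<U> \<subseteq> Qfin X \<and>
     (\<forall>\<F> H. Q_directed X \<F> \<and> H \<in> Pw X \<and> Q_conv X \<F> H \<and> up X H \<in> \<U> \<longrightarrow> \<F> \<inter> \<U> \<noteq> {})"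

definition upper_powerspace :: "'a topology \<Rightarrow> 'a set topology" where
  "upper_powerspace X = topology (Q_open X)"

text \<open>The abstraction function \<open>topology\<close> is only meaningful for families that form a topology, which
  \<open>Q_open X\<close> does.\<close>

lemma spec_le_refl: "x \<in> topspace X \<Longrightarrow> spec_le X x x"
  by (auto simp: spec_le_def in_closure_of)

lemma Q_open_upper:
  assumes U: "Q_open X \<U>" and A: "A \<in> \<U>" and B: "B \<in> Qfin X" and le: "Q_le A B"
  shows "B \<in> \<U>"
proof -
  obtain H where H: "H \<in> Pw X" "A = up X H"
    using U A by (auto simp: Q_open_def Qfin_def)
  then have "finite H" "H \<subseteq> topspace X" by (auto simp: Pw_def)
  obtain f :: "nat \<Rightarrow> 'a" and m where f: "H = f ` {i. i < m}"
    using finite_imp_nat_seg_image_inj_on[OF \<open>finite H\<close>] by auto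
  define D where "D = (\<lambda>i. {f (i - 1)})"
  have inH: "f (i - 1) \<in> H" if "i \<in> {1..m}" for i
    using that f by auto
  have ex: "\<exists>i\<in>{1..m}. f (i - 1) = h" if hH: "h \<in> H" for h
  proof -
    obtain j where "j < m" "h = f j" using hH f by auto
    then show ?thesis by (intro bexI[of _ "Suc j"]) auto
  qed
  have conv: "dir_conv X (D i) (f (i - 1))" "directed_in X (D i)" if "i \<in> {1..m}" for i
    using inH[OF that] \<open>H \<subseteq> topspace X\<close>
    by (auto simp: D_def dir_conv_def directed_in_def intro: spec_le_refl)
  have "Q_conv X {B} H"
    unfolding Q_conv_def
  proof (intro exI[of _ m] exI[of _ D] conjI ballI)
    fix d assume d: "d \<in> Pi\<^sub>E {1..m} D"
    have "A \<subseteq> (\<Union>i\<in>{1..m}. up X {d i})"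
    proof
      fix x assume "x \<in> A"
      then obtain h where h: "h \<in> H" "x \<in> up X {h}" by (auto simp: H up_def)
      then obtain i where i: "i \<in> {1..m}" "f (i - 1) = h" using ex by blast
      then have "d i = h" using d by (auto simp: D_def PiE_def Pi_def)
      then show "x \<in> (\<Union>i\<in>{1..m}. up X {d i})" using h i by auto
    qed
    then show "\<exists>A\<in>{B}. A \<subseteq> (\<Union>i\<in>{1..m}. up X {d i})"
      using le by (auto simp: Q_le_def)
  next
    fix i assume "i \<in> {1..m}"
    then show "H \<inter> {x. dir_conv X (D i) x} \<noteq> {}" using conv(1) inH by blast
  next
    fix h assume "h \<in> H"
    then show "\<exists>i\<in>{1..m}. dir_conv X (D i) h" using ex conv(1) by metis
  qed (use conv(2) in blast)
  moreover have "Q_directed X {B}" using B by (auto simp: Q_directed_def Q_le_def)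
  ultimately have "{B} \<inter> \<U> \<noteq> {}" using U A H unfolding Q_open_def by blast
  then show ?thesis by auto
qed

lemma istopology_Q_open: "istopology (Q_open X)"
  unfolding istopology_def
proof (intro conjI allI impI)
  fix S T assume S: "Q_open X S" and T: "Q_open X T"
  show "Q_open X (S \<inter> T)"
    unfolding Q_open_def
  proof (intro conjI allI impI)
    show "S \<inter> T \<subseteq> Qfin X" using S by (auto simp: Q_open_def)
  next
    fix \<F> H assume a: "Q_directed X \<F> \<and> H \<in> Pw X \<and> Q_conv X \<F> H \<and> up X H \<in> S \<inter> T"
    then obtain A B where "A \<in> \<F> \<inter> S" "B \<in> \<F> \<inter> T"
      using S T unfolding Q_open_def by (metis IntD1 IntD2 ex_in_conv)
    moreover then obtain C where "C \<in> \<F>" "Q_le A C" "Q_le B C"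
      using a unfolding Q_directed_def by blast
    moreover then have "C \<in> Qfin X" using a by (auto simp: Q_directed_def)
    ultimately have "C \<in> \<F> \<inter> (S \<inter> T)"
      using Q_open_upper[OF S] Q_open_upper[OF T] by blast
    then show "\<F> \<inter> (S \<inter> T) \<noteq> {}" by blast
  qed
next
  fix \<K> assume K: "\<forall>K\<in>\<K>. Q_open X K"
  show "Q_open X (\<Union>\<K>)"
    unfolding Q_open_def
  proof (intro conjI allI impI)
    show "\<Union>\<K> \<subseteq> Qfin X" using K by (auto simp: Q_open_def)
  next
    fix \<F> H assume a: "Q_directed X \<F> \<and> H \<in> Pw X \<and> Q_conv X \<F> H \<and> up X H \<in> \<Union>\<K>"
    then obtain K where "K \<in> \<K>" "up X H \<in> K" by blast
    then have "\<F> \<inter> K \<noteq> {}" using a K unfolding Q_open_def by blast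
    then show "\<F> \<inter> \<Union>\<K> \<noteq> {}" using \<open>K \<in> \<K>\<close> by blast
  qed
qed

lemma openin_upper_powerspace: "openin (upper_powerspace X) = Q_open X"
  by (simp add: upper_powerspace_def istopology_Q_open topology_inverse')

lemma topspace_upper_powerspace: "topspace (upper_powerspace X) = Qfin X"
proof -
  have "Q_open X (Qfin X)"
    by (auto simp: Q_open_def Q_directed_def)
  then show ?thesis
    by (auto simp: topspace_def openin_upper_powerspace Q_open_def)
qed

end

theory Submission
  imports Defs
begin

text \<open>
  The upper powerspace of an arbitrary space is defined by convergence classes, which are awkward to
  compute with. The proof rests on the observation that over a \<^emph>\<open>c-space\<close> the topology has
  a concrete description: it is the upper Vietoris topology, whose basic open sets are
  \<open>\<box>U = {A. A \<subseteq> U}\<close> for \<open>U\<close> open in \<open>X\<close>. More precisely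
  (\<open>Q_open_approx\<close>), every member \<open>A\<close> of an open family \<open>\<U>\<close>
  lies in the interior of some \<open>\<up>G \<in> \<U>\<close> with \<open>G\<close> finite: take
  \<open>A = \<up>H\<close>, replace each point of \<open>H\<close> by the directed set of its approximants, and note
  that the resulting finite choices form a directed family converging to \<open>A\<close>.

  A d-continuous space is a c-space by the interpolation property of the way-below relation, so this
  description applies. It shows at once that the powerspace is a c-space ordered by reverse
  inclusion, and every \<open>T\<^sub>0\<close> c-space is directed because the approximants of a point
  converge to it.

  Finally a quasi-finitely separating map \<open>\<delta>\<close> on \<open>X\<close> extends to the single-valued
  map \<open>A \<mapsto> \<up>(\<Union>x\<in>A. \<delta> x)\<close> on the powerspace. The preimage of \<open>\<box>U\<close> is
  \<open>\<box>{x. \<delta> x \<subseteq> U}\<close>, so clause (iii) gives continuity; the finite set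
  \<open>F\<close> of clause (ii) yields the finite set \<open>{\<up>G. {} \<noteq> G \<subseteq> F}\<close> witnessing finite separation. A
  finitely generated \<open>\<up>H\<close> involves only finitely many points, so directedness of the
  quasi-approximate identity turns pointwise convergence on \<open>X\<close> into convergence on the
  powerspace.
\<close>

section \<open>Specialization order and convergence\<close>

lemma spec_le_iff:
  "spec_le X x y \<longleftrightarrow> x \<in> topspace X \<and> (\<forall>U. openin X U \<and> x \<in> U \<longrightarrow> y \<in> U)"
  by (auto simp: spec_le_def in_closure_of)

lemma spec_le_trans: "spec_le X x y \<Longrightarrow> spec_le X y z \<Longrightarrow> spec_le X x z"
  by (auto simp: spec_le_iff)

lemma spec_le_topspace:
  assumes "spec_le X x y"
  shows "x \<in> topspace X" "y \<in> topspace X"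
  using assms by (auto simp: spec_le_iff)

lemma up_subset_topspace: "up X A \<subseteq> topspace X"
  by (auto simp: up_def)

lemma subset_up: "A \<subseteq> topspace X \<Longrightarrow> A \<subseteq> up X A"
  by (auto simp: up_def intro: spec_le_refl)

lemma up_least: "A \<subseteq> up X B \<Longrightarrow> up X A \<subseteq> up X B"
  unfolding up_def using spec_le_trans[of X] by blast

lemma up_mono: "A \<subseteq> B \<Longrightarrow> up X A \<subseteq> up X B"
  by (auto simp: up_def)

lemma up_subset_open: "openin X U \<Longrightarrow> A \<subseteq> U \<Longrightarrow> up X A \<subseteq> U"
  by (auto simp: up_def spec_le_iff)

lemma mem_up_singleton: "y \<in> up X {x} \<longleftrightarrow> spec_le X x y"
  by (auto simp: up_def dest: spec_le_topspace)

lemma dir_convI: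
  assumes "x \<in> topspace X" "\<And>U. openin X U \<Longrightarrow> x \<in> U \<Longrightarrow> D \<inter> U \<noteq> {}"
  shows "dir_conv X D x"
  unfolding dir_conv_def
proof (intro conjI allI impI)
  fix U assume U: "openin X U \<and> x \<in> U"
  then obtain d where "d \<in> D" "d \<in> U" using assms(2) by blast
  then show "\<exists>d0\<in>D. \<forall>d\<in>D. spec_le X d0 d \<longrightarrow> d \<in> U"
    using U by (auto simp: spec_le_iff intro!: bexI[of _ d])
qed (rule assms)

lemma dir_convD:
  assumes "directed_in X D" "dir_conv X D x" "openin X U" "x \<in> U"
  shows "\<exists>d\<in>D. d \<in> U"
proof -
  obtain d where d: "d \<in> D" "\<forall>e\<in>D. spec_le X d e \<longrightarrow> e \<in> U"
    using assms unfolding dir_conv_def by blast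
  then have "spec_le X d d" using assms(1) by (auto simp: directed_in_def intro: spec_le_refl)
  then show ?thesis using d by blast
qed

lemma open_imp_directed_open:
  assumes "openin X U"
  shows "directed_open X U"
  using dir_convD[OF _ _ assms] openin_subset[OF assms] unfolding directed_open_def by blast


section \<open>c-spaces\<close>

definition approximants :: "'a topology \<Rightarrow> 'a \<Rightarrow> 'a set" where
  "approximants X x = {y \<in> topspace X. x \<in> X interior_of (up X {y})}"

text \<open>Two approximants \<open>a, b\<close> of \<open>x\<close> have the open neighbourhood
  \<open>(\<up>a)\<degree> \<inter> (\<up>b)\<degree>\<close> of \<open>x\<close> in common; an approximant of \<open>x\<close> inside it is above both.\<close>

lemma approximants_directed_conv:
  assumes c: "c_space X" and x: "x \<in> topspace X"
  shows "directed_in X (approximants X x)" "dir_conv X (approximants X x) x"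
proof -
  have ex: "\<exists>y\<in>U. y \<in> approximants X x" if U: "openin X U" "x \<in> U" for U
  proof -
    obtain y where "y \<in> U" "x \<in> X interior_of (up X {y})"
      using c U unfolding c_space_def by blast
    then show ?thesis using openin_subset[OF U(1)] by (auto simp: approximants_def)
  qed
  show "dir_conv X (approximants X x) x"
    using ex by (intro dir_convI x) blast
  show "directed_in X (approximants X x)"
    unfolding directed_in_def
  proof (intro conjI ballI)
    show "approximants X x \<noteq> {}" using ex[OF openin_topspace x] by blast
    show "approximants X x \<subseteq> topspace X" by (auto simp: approximants_def)
  next
    fix a b assume ab: "a \<in> approximants X x" "b \<in> approximants X x"
    let ?V = "X interior_of (up X {a}) \<inter> X interior_of (up X {b})"
    have "openin X ?V" "x \<in> ?V" using ab by (auto simp: approximants_def)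
    then obtain y where y: "y \<in> ?V" "y \<in> approximants X x" using ex by blast
    then have "y \<in> up X {a}" "y \<in> up X {b}" using interior_of_subset by fast+
    then show "\<exists>c\<in>approximants X x. spec_le X a c \<and> spec_le X b c"
      using y(2) by (auto simp: mem_up_singleton)
  qed
qed

lemma c_space_imp_directed_space:
  assumes c: "c_space X"
  shows "directed_space X"
proof -
  have "openin X U" if U: "directed_open X U" for U
  proof (subst openin_subopen, intro ballI)
    fix x assume x: "x \<in> U"
    have sub: "U \<subseteq> topspace X" using U by (auto simp: directed_open_def)
    have "approximants X x \<inter> U \<noteq> {}"
      using approximants_directed_conv[OF c, of x] U x sub unfolding directed_open_def by blast
    then obtain y where y: "y \<in> U" "x \<in> X interior_of (up X {y})"
      by (auto simp: approximants_def)
    have "up X {y} \<subseteq> U"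
    proof
      fix z assume "z \<in> up X {y}"
      then have le: "spec_le X y z" by (simp add: mem_up_singleton)
      \<comment> \<open>a directed open set is an upper set, since the constant net \<open>z\<close> converges to \<open>y\<close>\<close>
      have "directed_in X {z}" "dir_conv X {z} y"
        using le spec_le_topspace[OF le] by (auto simp: directed_in_def spec_le_iff dir_conv_def)
      then show "z \<in> U" using U y(1) unfolding directed_open_def by blast
    qed
    then show "\<exists>T. openin X T \<and> x \<in> T \<and> T \<subseteq> U"
      using y(2) interior_of_subset[of X "up X {y}"]
      by (intro exI[of _ "X interior_of (up X {y})"]) auto
  qed
  then show ?thesis
    using c open_imp_directed_open unfolding directed_space_def c_space_def by blast
qed

text \<open>The points \<open>u \<lless> w \<lless> z\<close> again form a directed set converging to \<open>z\<close>, so one of them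
  dominates any given \<open>y \<lless> z\<close>.\<close>

lemma way_below_interpolation:
  assumes X: "d_continuous X" and yz: "way_below X y z"
  shows "\<exists>w. way_below X y w \<and> way_below X w z"
proof -
  have dc: "directed_in X {y \<in> topspace X. way_below X y x}"
    "dir_conv X {y \<in> topspace X. way_below X y x} x" if "x \<in> topspace X" for x
    using X that by (auto simp: d_continuous_def)
  have mono_right: "way_below X a c" if "way_below X a b" "spec_le X b c" for a b c
    using that spec_le_topspace[OF that(2)]
    unfolding way_below_def dir_conv_def by (metis spec_le_iff)
  have mono_left: "way_below X a c" if "spec_le X a b" "way_below X b c" for a b c
    using that spec_le_topspace[OF that(1)] unfolding way_below_def by (meson spec_le_trans)
  have z: "z \<in> topspace X" using yz by (auto simp: way_below_def)
  have wt: "w \<in> topspace X" if "way_below X u w" for u w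
    using that by (auto simp: way_below_def)
  have ut: "u \<in> topspace X" if "way_below X u w" for u w
    using that by (auto simp: way_below_def)
  let ?E = "{u. \<exists>w. way_below X u w \<and> way_below X w z}"
  have conv: "?E \<inter> U \<noteq> {}" if U: "openin X U" "z \<in> U" for U
  proof -
    obtain w where w: "way_below X w z" "w \<in> U"
      using dir_convD[OF dc[OF z] U] by blast
    then obtain u where "way_below X u w" "u \<in> U"
      using dir_convD[OF dc[OF ut[OF w(1)]] U(1)] by blast
    then show ?thesis using w by blast
  qed
  have "directed_in X ?E"
    unfolding directed_in_def
  proof (intro conjI ballI)
    show "?E \<noteq> {}" using conv[OF openin_topspace z] by blast
    show "?E \<subseteq> topspace X" using ut by blast
  next
    fix a b assume "a \<in> ?E" "b \<in> ?E"
    then obtain v w where vw: "way_below X a v" "way_below X v z" "way_below X b w" "way_below X w z"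
      by blast
    then obtain t where t: "way_below X t z" "spec_le X v t" "spec_le X w t"
      using dc(1)[OF z] ut unfolding directed_in_def by blast
    then have "way_below X a t" "way_below X b t" using vw mono_right by blast+
    then obtain c where "way_below X c t" "spec_le X a c" "spec_le X b c"
      using dc(1)[OF ut[OF t(1)]] ut unfolding directed_in_def by blast
    then show "\<exists>c\<in>?E. spec_le X a c \<and> spec_le X b c" using t(1) by blast
  qed
  moreover have "dir_conv X ?E z" using conv by (intro dir_convI z) blast
  ultimately obtain u where "u \<in> ?E" "spec_le X y u"
    using yz unfolding way_below_def by blast
  then show ?thesis using mono_left by blast
qed

lemma d_continuous_imp_c_space:
  assumes X: "d_continuous X"
  shows "c_space X"
  unfolding c_space_def
proof (intro conjI allI impI)
  show "t0_space X" using X by (auto simp: d_continuous_def directed_space_def)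
next
  fix U x assume Ux: "openin X U \<and> x \<in> U"
  then have x: "x \<in> topspace X" using openin_subset by blast
  then obtain y where y: "y \<in> U" "way_below X y x"
    using X Ux dir_convD[of X "{y \<in> topspace X. way_below X y x}" x U]
    unfolding d_continuous_def by blast
  let ?W = "{z. way_below X y z}"
  \<comment> \<open>interpolation makes the set of points far above \<open>y\<close> directed open\<close>
  have "directed_open X ?W"
    unfolding directed_open_def
  proof (intro conjI allI impI)
    show "?W \<subseteq> topspace X" by (auto simp: way_below_def)
  next
    fix D z assume D: "directed_in X D \<and> z \<in> ?W \<and> dir_conv X D z"
    then obtain w where w: "way_below X y w" "way_below X w z"
      using way_below_interpolation[OF X] by blast
    then obtain d where d: "d \<in> D" "spec_le X w d" using D unfolding way_below_def by blast
    then have "way_below X y d"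
      using w(1) spec_le_topspace[OF d(2)]
      unfolding way_below_def dir_conv_def by (metis spec_le_iff)
    then show "D \<inter> ?W \<noteq> {}" using d(1) by blast
  qed
  then have "openin X ?W" using X by (auto simp: d_continuous_def directed_space_def)
  moreover have "?W \<subseteq> up X {y}"
  proof
    fix z assume "z \<in> ?W"
    then have yz: "way_below X y z" by simp
    then have z: "z \<in> topspace X" by (simp add: way_below_def)
    then have "directed_in X {z}" "dir_conv X {z} z"
      by (auto simp: directed_in_def dir_conv_def intro: spec_le_refl)
    then show "z \<in> up X {y}" using yz by (auto simp: way_below_def mem_up_singleton)
  qed
  ultimately have "x \<in> X interior_of (up X {y})"
    using y(2) interior_of_maximal by blast
  then show "\<exists>y\<in>U. x \<in> X interior_of (up X {y})" using y(1) by blast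
qed


section \<open>The upper powerspace of a c-space\<close>

lemma Qfin_E:
  assumes "A \<in> Qfin X"
  obtains H where "finite H" "H \<noteq> {}" "H \<subseteq> topspace X" "H \<subseteq> A" "A = up X H"
  using assms subset_up by (fastforce simp: Qfin_def Pw_def)

lemma up_in_Qfin: "finite H \<Longrightarrow> H \<noteq> {} \<Longrightarrow> H \<subseteq> topspace X \<Longrightarrow> up X H \<in> Qfin X"
  by (auto simp: Qfin_def Pw_def)

lemma Qfin_subset_topspace: "A \<in> Qfin X \<Longrightarrow> A \<subseteq> topspace X"
  by (auto simp: Qfin_def up_def)

lemma Qfin_up: "A \<in> Qfin X \<Longrightarrow> up X A = A"
  by (metis Qfin_E subset_refl subset_up subset_antisym up_least up_subset_topspace)

definition box :: "'a topology \<Rightarrow> 'a set \<Rightarrow> 'a set set" where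
  "box X U = {A \<in> Qfin X. A \<subseteq> U}"

text \<open>Each directed set \<open>D i\<close> of the convergence class has a limit among the generators of a member
  of \<open>\<box>U\<close>, hence meets \<open>U\<close>; one point of \<open>U\<close> from each \<open>D i\<close> bounds a member of the family
  inside \<open>U\<close>.\<close>

lemma Q_open_box:
  assumes U: "openin X U"
  shows "Q_open X (box X U)"
  unfolding Q_open_def
proof (intro conjI allI impI)
  show "box X U \<subseteq> Qfin X" by (auto simp: box_def)
next
  fix \<F> H
  assume a: "Q_directed X \<F> \<and> H \<in> Pw X \<and> Q_conv X \<F> H \<and> up X H \<in> box X U"
  then have HU: "H \<subseteq> U" using subset_up[of H X] by (auto simp: box_def Pw_def)
  obtain n :: nat and D where D: "\<And>i. i \<in> {1..n} \<Longrightarrow> directed_in X (D i)"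
    "\<And>i. i \<in> {1..n} \<Longrightarrow> H \<inter> {x. dir_conv X (D i) x} \<noteq> {}"
    and F: "\<forall>d \<in> Pi\<^sub>E {1..n} D. \<exists>A\<in>\<F>. A \<subseteq> (\<Union>i\<in>{1..n}. up X {d i})"
    using a unfolding Q_conv_def by metis
  have "\<exists>d\<in>D i. d \<in> U" if i: "i \<in> {1..n}" for i
  proof -
    obtain h where "h \<in> H" "dir_conv X (D i) h" using D(2)[OF i] by blast
    then show ?thesis using dir_convD[OF D(1)[OF i] _ U] HU by blast
  qed
  then obtain e where e: "\<And>i. i \<in> {1..n} \<Longrightarrow> e i \<in> D i \<and> e i \<in> U" by metis
  have "restrict e {1..n} \<in> Pi\<^sub>E {1..n} D" using e by auto
  then obtain A where A: "A \<in> \<F>" "A \<subseteq> (\<Union>i\<in>{1..n}. up X {restrict e {1..n} i})"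
    using F by blast
  have "up X {restrict e {1..n} i} \<subseteq> U" if "i \<in> {1..n}" for i
    using up_subset_open[OF U, of "{e i}"] e[OF that] that by auto
  then have "A \<subseteq> U" using A(2) by blast
  then show "\<F> \<inter> box X U \<noteq> {}" using A(1) a by (auto simp: box_def Q_directed_def)
qed

text \<open>The convergence class is only applied to one kind of family: the finite sets picking one
  approximant from below each generator of \<open>A\<close>. This already forces \<open>\<U>\<close> to be a union of
  boxes.\<close>

lemma Q_open_approx:
  assumes c: "c_space X" and U: "Q_open X \<U>" and A: "A \<in> \<U>"
  shows "\<exists>G. G \<in> Pw X \<and> up X G \<in> \<U> \<and> A \<subseteq> X interior_of (up X G)"
proof -
  have "A \<in> Qfin X" using U A by (auto simp: Q_open_def)
  then obtain H where H: "finite H" "H \<noteq> {}" "H \<subseteq> topspace X" "A = up X H" by (rule Qfin_E)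
  obtain h :: "nat \<Rightarrow> 'a" and n where hn: "H = h ` {1..n}"
    using ex_bij_betw_nat_finite_1[OF H(1)] by (metis bij_betw_imp_surj_on)
  have n: "{1..n} \<noteq> {}" using hn H(2) by auto
  have ht: "h i \<in> topspace X" if "i \<in> {1..n}" for i using hn H(3) that by blast
  let ?D = "\<lambda>i. approximants X (h i)"
  let ?up = "\<lambda>d. up X (d ` {1..n})"
  note ap = approximants_directed_conv[OF c ht]
  have Dt: "d ` {1..n} \<in> Pw X" if "d \<in> Pi\<^sub>E {1..n} ?D" for d
    using that n by (auto simp: Pw_def approximants_def PiE_def Pi_def)
  let ?F = "?up ` Pi\<^sub>E {1..n} ?D"
  have "Q_directed X ?F"
    unfolding Q_directed_def
  proof (intro conjI ballI)
    have "\<exists>e. \<forall>i\<in>{1..n}. e i \<in> ?D i"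
      using ap(1) unfolding directed_in_def by (intro bchoice) blast
    then obtain e where "\<forall>i\<in>{1..n}. e i \<in> ?D i" by blast
    then have "restrict e {1..n} \<in> Pi\<^sub>E {1..n} ?D" by auto
    then show "?F \<noteq> {}" by blast
    show "?F \<subseteq> Qfin X" using Dt by (auto simp: Qfin_def)
  next
    fix B C assume "B \<in> ?F" "C \<in> ?F"
    then obtain d e where d: "d \<in> Pi\<^sub>E {1..n} ?D" "B = ?up d" and e: "e \<in> Pi\<^sub>E {1..n} ?D" "C = ?up e"
      by blast
    have "\<exists>k. \<forall>i\<in>{1..n}. k i \<in> ?D i \<and> spec_le X (d i) (k i) \<and> spec_le X (e i) (k i)"
    proof (intro bchoice ballI)
      fix i assume i: "i \<in> {1..n}"
      then have "d i \<in> ?D i" "e i \<in> ?D i" using d(1) e(1) by (auto simp: PiE_def Pi_def)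
      then show "\<exists>y. y \<in> ?D i \<and> spec_le X (d i) y \<and> spec_le X (e i) y"
        using ap(1)[OF i] unfolding directed_in_def by blast
    qed
    then obtain k where k: "\<forall>i\<in>{1..n}. k i \<in> ?D i \<and> spec_le X (d i) (k i) \<and> spec_le X (e i) (k i)"
      by blast
    let ?k = "restrict k {1..n}"
    have kP: "?k \<in> Pi\<^sub>E {1..n} ?D" using k by auto
    have "?k ` {1..n} \<subseteq> ?up d" "?k ` {1..n} \<subseteq> ?up e"
      using k spec_le_topspace(2) by (fastforce simp: up_def)+
    then have "?up ?k \<subseteq> ?up d" "?up ?k \<subseteq> ?up e"
      using up_least by blast+
    then show "\<exists>K\<in>?F. Q_le B K \<and> Q_le C K"
      using kP unfolding Q_le_def d(2) e(2) by blast
  qed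
  moreover have "Q_conv X ?F H"
    unfolding Q_conv_def
  proof (intro exI[of _ n] exI[of _ ?D] conjI ballI)
    fix d assume d: "d \<in> Pi\<^sub>E {1..n} ?D"
    have "?up d \<subseteq> (\<Union>i\<in>{1..n}. up X {d i})" by (auto simp: up_def)
    then show "\<exists>A\<in>?F. A \<subseteq> (\<Union>i\<in>{1..n}. up X {d i})" using d by blast
  qed (use ap hn in \<open>blast+\<close>)
  moreover have "H \<in> Pw X" using H by (simp add: Pw_def)
  ultimately have "?F \<inter> \<U> \<noteq> {}" using U A H(4) unfolding Q_open_def by blast
  then obtain d where d: "d \<in> Pi\<^sub>E {1..n} ?D" "?up d \<in> \<U>" by blast
  have "h i \<in> X interior_of (?up d)" if i: "i \<in> {1..n}" for i
  proof -
    have "h i \<in> X interior_of (up X {d i})" using d(1) i by (auto simp: approximants_def PiE_def Pi_def)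
    moreover have "up X {d i} \<subseteq> ?up d" using i by (intro up_mono) auto
    ultimately show ?thesis using interior_of_mono by blast
  qed
  then have "H \<subseteq> X interior_of (?up d)" using hn by blast
  then have "A \<subseteq> X interior_of (?up d)" unfolding H(4) by (intro up_subset_open) auto
  then show ?thesis using Dt[OF d(1)] d(2) by blast
qed

lemma Q_open_box_basis:
  assumes c: "c_space X" and U: "Q_open X \<U>" and A: "A \<in> \<U>"
  shows "\<exists>U. openin X U \<and> A \<in> box X U \<and> box X U \<subseteq> \<U>"
proof -
  obtain G where G: "G \<in> Pw X" "up X G \<in> \<U>" "A \<subseteq> X interior_of (up X G)"
    using Q_open_approx[OF assms] by blast
  have "box X (X interior_of (up X G)) \<subseteq> \<U>"
  proof
    fix B assume "B \<in> box X (X interior_of (up X G))"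
    then have "B \<in> Qfin X" "B \<subseteq> up X G" using interior_of_subset by (fastforce simp: box_def)+
    then show "B \<in> \<U>" using Q_open_upper[OF U G(2)] by (simp add: Q_le_def)
  qed
  moreover have "A \<in> Qfin X" using U A by (auto simp: Q_open_def)
  ultimately show ?thesis using G(3) by (intro exI[of _ "X interior_of (up X G)"]) (auto simp: box_def)
qed

text \<open>Open families are upward closed for reverse inclusion, and boxes alone already separate a set
  from any point outside it.\<close>

lemma spec_le_upper_powerspace:
  "spec_le (upper_powerspace X) A B \<longleftrightarrow> A \<in> Qfin X \<and> B \<in> Qfin X \<and> B \<subseteq> A"
proof
  assume le: "spec_le (upper_powerspace X) A B"
  then have AB: "A \<in> Qfin X" "B \<in> Qfin X"
    using spec_le_topspace[OF le] by (simp_all add: topspace_upper_powerspace)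
  have "B \<subseteq> A"
  proof
    fix b assume b: "b \<in> B"
    then have bt: "b \<in> topspace X" using Qfin_subset_topspace[OF AB(2)] by blast
    show "b \<in> A"
    proof (rule ccontr)
      assume "b \<notin> A"
      \<comment> \<open>the complement of \<open>\<down>b\<close> is an open set that contains \<open>A\<close> but not \<open>B\<close>\<close>
      let ?U = "topspace X - X closure_of {b}"
      have "A \<subseteq> ?U"
      proof
        fix a assume a: "a \<in> A"
        have "\<not> spec_le X a b"
        proof
          assume "spec_le X a b"
          then have "b \<in> up X A" using a bt by (auto simp: up_def)
          then show False using Qfin_up[OF AB(1)] \<open>b \<notin> A\<close> by simp
        qed
        then show "a \<in> ?U" using a Qfin_subset_topspace[OF AB(1)] by (auto simp: spec_le_def)
      qed
      then have "A \<in> box X ?U" using AB by (simp add: box_def)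
      moreover have "Q_open X (box X ?U)" by (intro Q_open_box) auto
      ultimately have "B \<in> box X ?U"
        using le by (simp add: spec_le_iff openin_upper_powerspace)
      then have "b \<notin> X closure_of {b}" using b by (auto simp: box_def)
      then show False using spec_le_refl[OF bt] by (simp add: spec_le_def)
    qed
  qed
  then show "A \<in> Qfin X \<and> B \<in> Qfin X \<and> B \<subseteq> A" using AB by blast
next
  assume "A \<in> Qfin X \<and> B \<in> Qfin X \<and> B \<subseteq> A"
  then show "spec_le (upper_powerspace X) A B"
    using Q_open_upper by (auto simp: spec_le_iff topspace_upper_powerspace openin_upper_powerspace Q_le_def)
qed

lemma c_space_upper_powerspace:
  assumes c: "c_space X"
  shows "c_space (upper_powerspace X)"
  unfolding c_space_def
proof (intro conjI allI impI)
  show "t0_space (upper_powerspace X)"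
    unfolding t0_space_def
  proof (intro ballI impI)
    fix A B assume AB: "A \<in> topspace (upper_powerspace X)" "B \<in> topspace (upper_powerspace X)" "A \<noteq> B"
    have "\<not> (spec_le (upper_powerspace X) A B \<and> spec_le (upper_powerspace X) B A)"
      using AB(3) by (auto simp: spec_le_upper_powerspace)
    then show "\<exists>U. openin (upper_powerspace X) U \<and> (A \<notin> U) = (B \<in> U)"
      using AB(1,2) unfolding spec_le_iff by blast
  qed
next
  fix \<U> A assume "openin (upper_powerspace X) \<U> \<and> A \<in> \<U>"
  then have U: "Q_open X \<U>" "A \<in> \<U>" by (simp_all add: openin_upper_powerspace)
  then obtain G where G: "G \<in> Pw X" "up X G \<in> \<U>" "A \<subseteq> X interior_of (up X G)"
    using Q_open_approx[OF c] by blast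
  let ?B = "box X (X interior_of (up X G))"
  have "A \<in> ?B" using U G(3) by (auto simp: box_def Q_open_def)
  moreover have "openin (upper_powerspace X) ?B"
    by (simp add: openin_upper_powerspace Q_open_box)
  moreover have "?B \<subseteq> up (upper_powerspace X) {up X G}"
    using G(1) interior_of_subset[of X "up X G"]
    by (auto simp: box_def mem_up_singleton spec_le_upper_powerspace Qfin_def)
  ultimately have "A \<in> upper_powerspace X interior_of (up (upper_powerspace X) {up X G})"
    using interior_of_maximal by blast
  then show "\<exists>y\<in>\<U>. A \<in> upper_powerspace X interior_of (up (upper_powerspace X) {y})"
    using G(2) by blast
qed


section \<open>Extending separating maps to the powerspace\<close>

text \<open>The union runs over all points of \<open>A\<close>, not over a chosen set of generators, so that the value
  is visibly independent of the presentation of \<open>A\<close>.\<close>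

definition extension :: "'a topology \<Rightarrow> ('a \<Rightarrow> 'a set) \<Rightarrow> 'a set \<Rightarrow> 'a set" where
  "extension X \<delta> A = up X (\<Union>x\<in>A. \<delta> x)"

lemma quasi_finitely_separating_approx:
  assumes "quasi_finitely_separating X \<delta>" "directed_in X D" "dir_conv X D x" "openin X U" "\<delta> x \<subseteq> U"
  shows "\<exists>d\<in>D. \<delta> d \<subseteq> U"
  using assms unfolding quasi_finitely_separating_def by meson

text \<open>By clause (i), \<open>\<up>\<delta>(x)\<close> shrinks as \<open>x\<close> grows, so the points of \<open>\<up>H\<close> contribute
  nothing beyond the generators; hence the extension stays within the finitely generated sets.\<close>

lemma extension_up:
  assumes q: "quasi_finitely_separating X \<delta>" and H: "H \<subseteq> topspace X"
  shows "extension X \<delta> (up X H) = up X (\<Union>x\<in>H. \<delta> x)"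
proof
  have "\<delta> x \<subseteq> up X (\<Union>x\<in>H. \<delta> x)" if x: "x \<in> up X H" for x
  proof -
    obtain h where h: "h \<in> H" "spec_le X h x" using x by (auto simp: up_def)
    then have "\<delta> x \<subseteq> up X (\<delta> h)"
      using q spec_le_topspace[OF h(2)] unfolding quasi_finitely_separating_def by blast
    also have "\<dots> \<subseteq> up X (\<Union>x\<in>H. \<delta> x)" using h(1) by (intro up_mono) auto
    finally show ?thesis .
  qed
  then show "extension X \<delta> (up X H) \<subseteq> up X (\<Union>x\<in>H. \<delta> x)"
    unfolding extension_def by (intro up_least) auto
  show "up X (\<Union>x\<in>H. \<delta> x) \<subseteq> extension X \<delta> (up X H)"
    unfolding extension_def using subset_up[OF H] by (intro up_mono) auto
qed

lemma extension_in_Qfin: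
  assumes q: "quasi_finitely_separating X \<delta>" and A: "A \<in> Qfin X"
  shows "extension X \<delta> A \<in> Qfin X"
proof -
  obtain H where H: "finite H" "H \<noteq> {}" "H \<subseteq> topspace X" "A = up X H" using A by (rule Qfin_E)
  have "\<delta> x \<in> Pw X" if "x \<in> H" for x
    using q H(3) that by (auto simp: quasi_finitely_separating_def)
  then show ?thesis
    unfolding H(4) extension_up[OF q H(3)] using H(1,2)
    by (intro up_in_Qfin) (auto simp: Pw_def)
qed

text \<open>The preimage of \<open>\<box>U\<close> is \<open>\<box>V\<close> with \<open>V = {x. \<delta> x \<subseteq> U}\<close>, and clause (iii) says
  precisely that \<open>V\<close> is directed open.\<close>

lemma continuous_extension:
  assumes c: "c_space X" and q: "quasi_finitely_separating X \<delta>"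
  shows "continuous_map (upper_powerspace X) (upper_powerspace X) (extension X \<delta>)"
  unfolding continuous_map_def
proof (intro conjI allI impI)
  show "extension X \<delta> \<in> topspace (upper_powerspace X) \<rightarrow> topspace (upper_powerspace X)"
    using extension_in_Qfin[OF q] by (auto simp: topspace_upper_powerspace)
next
  fix \<U> assume "openin (upper_powerspace X) \<U>"
  then have U: "Q_open X \<U>" by (simp add: openin_upper_powerspace)
  let ?P = "{A \<in> topspace (upper_powerspace X). extension X \<delta> A \<in> \<U>}"
  show "openin (upper_powerspace X) ?P"
  proof (subst openin_subopen, intro ballI)
    fix A assume "A \<in> ?P"
    then have A: "A \<in> Qfin X" "extension X \<delta> A \<in> \<U>" by (auto simp: topspace_upper_powerspace)
    obtain U where U: "openin X U" "extension X \<delta> A \<in> box X U" "box X U \<subseteq> \<U>"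
      using Q_open_box_basis[OF c U A(2)] by blast
    let ?V = "{x \<in> topspace X. \<delta> x \<subseteq> U}"
    have \<delta>t: "\<delta> x \<subseteq> topspace X" if "x \<in> topspace X" for x
      using q that by (auto simp: quasi_finitely_separating_def Pw_def)
    have "directed_open X ?V"
      unfolding directed_open_def
    proof (intro conjI allI impI)
      fix D x assume D: "directed_in X D \<and> x \<in> ?V \<and> dir_conv X D x"
      then obtain d where "d \<in> D" "\<delta> d \<subseteq> U"
        using quasi_finitely_separating_approx[OF q _ _ U(1)] by blast
      then show "D \<inter> ?V \<noteq> {}" using D by (auto simp: directed_in_def)
    qed auto
    then have V: "openin X ?V"
      using c_space_imp_directed_space[OF c] by (auto simp: directed_space_def)
    have "box X ?V \<subseteq> ?P"
    proof
      fix B assume B: "B \<in> box X ?V"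
      then have "extension X \<delta> B \<subseteq> U"
        unfolding extension_def by (intro up_subset_open U) (auto simp: box_def)
      then show "B \<in> ?P"
        using B U(3) extension_in_Qfin[OF q] by (auto simp: box_def topspace_upper_powerspace)
    qed
    moreover have "A \<in> box X ?V"
    proof -
      have "\<delta> x \<subseteq> U" if x: "x \<in> A" for x
      proof -
        have "x \<in> topspace X" using Qfin_subset_topspace[OF A(1)] x by blast
        then have "\<delta> x \<subseteq> up X (\<delta> x)" by (intro subset_up \<delta>t)
        also have "\<dots> \<subseteq> extension X \<delta> A" unfolding extension_def using x by (intro up_mono) auto
        also have "\<dots> \<subseteq> U" using U(2) by (simp add: box_def)
        finally show ?thesis .
      qed
      then show ?thesis using A(1) Qfin_subset_topspace[OF A(1)] by (auto simp: box_def)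
    qed
    ultimately show "\<exists>T. openin (upper_powerspace X) T \<and> A \<in> T \<and> T \<subseteq> ?P"
      using Q_open_box[OF V] by (auto simp: openin_upper_powerspace)
  qed
qed

text \<open>Interpolating each generator of \<open>\<up>H\<close> separately inside the finite set \<open>F\<close> of clause (ii)
  interpolates the whole set by some \<open>\<up>G\<close> with \<open>G \<subseteq> F\<close>.\<close>

lemma finitely_separating_extension:
  assumes c: "c_space X" and q: "quasi_finitely_separating X \<delta>"
  shows "finitely_separating (upper_powerspace X) (extension X \<delta>)"
proof -
  obtain F where F: "finite F" "F \<subseteq> topspace X"
    "\<forall>x\<in>topspace X. \<exists>y\<in>F. x \<in> up X {y} \<and> up X {y} \<subseteq> up X (\<delta> x)"
    using q unfolding quasi_finitely_separating_def by blast
  let ?\<G> = "up X ` (Pow F - {{}})"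
  have "\<exists>B\<in>?\<G>. spec_le (upper_powerspace X) (extension X \<delta> A) B \<and> spec_le (upper_powerspace X) B A"
    if A: "A \<in> Qfin X" for A
  proof -
    obtain H where H: "finite H" "H \<noteq> {}" "H \<subseteq> topspace X" "A = up X H" using A by (rule Qfin_E)
    obtain g where g: "\<forall>x\<in>topspace X. g x \<in> F \<and> x \<in> up X {g x} \<and> up X {g x} \<subseteq> up X (\<delta> x)"
      using F(3) by metis
    let ?G = "g ` H"
    have G: "?G \<subseteq> F" "?G \<noteq> {}" using g H(2,3) by auto
    then have GQ: "up X ?G \<in> Qfin X"
      using F(1,2) by (intro up_in_Qfin) (auto intro: finite_subset)
    have "H \<subseteq> up X ?G"
    proof
      fix h assume h: "h \<in> H"
      then have "h \<in> up X {g h}" using g H(3) by blast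
      then show "h \<in> up X ?G" using h up_mono[of "{g h}" ?G X] by blast
    qed
    then have 1: "A \<subseteq> up X ?G" unfolding H(4) by (rule up_least)
    have "?G \<subseteq> up X (\<Union>x\<in>H. \<delta> x)"
    proof
      fix y assume "y \<in> ?G"
      then obtain h where h: "h \<in> H" "y = g h" by blast
      then have ht: "h \<in> topspace X" using H(3) by blast
      then have "y \<in> up X {g h}" using g F(2) h spec_le_refl[of y X] by (auto simp: mem_up_singleton)
      then have "y \<in> up X (\<delta> h)" using g ht by blast
      then show "y \<in> up X (\<Union>x\<in>H. \<delta> x)" using h up_mono[of "\<delta> h" "\<Union>x\<in>H. \<delta> x" X] by blast
    qed
    then have 2: "up X ?G \<subseteq> extension X \<delta> A"
      unfolding H(4) extension_up[OF q H(3)] by (rule up_least)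
    have "up X ?G \<in> ?\<G>" using G by blast
    then show ?thesis
      using 1 2 GQ A extension_in_Qfin[OF q A] by (auto simp: spec_le_upper_powerspace)
  qed
  moreover have "finite ?\<G>" using F(1) by simp
  moreover have "?\<G> \<subseteq> Qfin X"
  proof
    fix B assume "B \<in> ?\<G>"
    then obtain G where "B = up X G" "G \<subseteq> F" "G \<noteq> {}" by blast
    then show "B \<in> Qfin X"
      using F(1,2) finite_subset[of G F] up_in_Qfin[of G X] by simp
  qed
  ultimately show ?thesis
    unfolding finitely_separating_def topspace_upper_powerspace
    using continuous_extension[OF c q] by blast
qed

lemma directed_maps_finite_bound:
  assumes D: "directed_maps X \<D>" and H: "finite H" "H \<subseteq> topspace X"
    and open_U: "openin X U" and ex: "\<And>h. h \<in> H \<Longrightarrow> \<exists>\<delta>\<in>\<D>. \<delta> h \<subseteq> U"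
  shows "\<exists>\<delta>\<in>\<D>. \<forall>h\<in>H. \<delta> h \<subseteq> U"
  using H ex
proof (induction H rule: finite_induct)
  case empty
  then show ?case using D by (auto simp: directed_maps_def)
next
  case (insert h H)
  then obtain \<delta>1 \<delta>2 where d: "\<delta>1 \<in> \<D>" "\<forall>x\<in>H. \<delta>1 x \<subseteq> U" "\<delta>2 \<in> \<D>" "\<delta>2 h \<subseteq> U"
    by (metis insert_iff insert_subset)
  then obtain \<delta> where \<delta>: "\<delta> \<in> \<D>" "\<forall>x\<in>topspace X. \<delta> x \<subseteq> up X (\<delta>1 x) \<inter> up X (\<delta>2 x)"
    using D unfolding directed_maps_def by blast
  have "\<delta> x \<subseteq> U" if "x \<in> insert h H" for x
  proof -
    have xt: "x \<in> topspace X" using that insert.prems by blast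
    show ?thesis
    proof (cases "x = h")
      case True
      then show ?thesis using \<delta>(2) xt up_subset_open[OF open_U, of "\<delta>2 h"] d by blast
    next
      case False
      then show ?thesis using \<delta>(2) xt up_subset_open[OF open_U, of "\<delta>1 x"] d that by blast
    qed
  qed
  then show ?case using \<delta>(1) by blast
qed

lemma approximate_identity_extension:
  assumes c: "c_space X" and D: "quasi_approximate_identity X \<D>"
    and q: "\<And>\<delta>. \<delta> \<in> \<D> \<Longrightarrow> quasi_finitely_separating X \<delta>"
  shows "approximate_identity (upper_powerspace X) (extension X ` \<D>)"
proof -
  let ?Z = "upper_powerspace X"
  have dm: "directed_maps X \<D>" using D by (simp add: quasi_approximate_identity_def)
  then have ne: "\<D> \<noteq> {}" by (simp add: directed_maps_def)
  have ub: "\<exists>\<delta>\<in>\<D>. \<forall>A\<in>Qfin X. spec_le ?Z (extension X \<delta>1 A) (extension X \<delta> A) \<and>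
      spec_le ?Z (extension X \<delta>2 A) (extension X \<delta> A)"
    if d: "\<delta>1 \<in> \<D>" "\<delta>2 \<in> \<D>" for \<delta>1 \<delta>2
  proof -
    obtain \<delta> where \<delta>: "\<delta> \<in> \<D>" "\<forall>x\<in>topspace X. \<delta> x \<subseteq> up X (\<delta>1 x) \<inter> up X (\<delta>2 x)"
      using dm d unfolding directed_maps_def by blast
    have "extension X \<delta> A \<subseteq> extension X \<epsilon> A"
      if A: "A \<in> Qfin X" and le: "\<forall>x\<in>topspace X. \<delta> x \<subseteq> up X (\<epsilon> x)" for A \<epsilon>
    proof -
      have "\<delta> x \<subseteq> up X (\<Union>x\<in>A. \<epsilon> x)" if "x \<in> A" for x
      proof -
        have "\<delta> x \<subseteq> up X (\<epsilon> x)" using le that Qfin_subset_topspace[OF A] by blast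
        also have "\<dots> \<subseteq> up X (\<Union>x\<in>A. \<epsilon> x)" using that by (intro up_mono) auto
        finally show ?thesis .
      qed
      then show ?thesis unfolding extension_def by (intro up_least) auto
    qed
    then have "\<forall>A\<in>Qfin X. extension X \<delta> A \<subseteq> extension X \<delta>1 A \<and> extension X \<delta> A \<subseteq> extension X \<delta>2 A"
      using \<delta>(2) by blast
    then show ?thesis
      using \<delta>(1) extension_in_Qfin[OF q] d
      by (intro bexI[of _ \<delta>]) (auto simp: spec_le_upper_powerspace)
  qed
  have conv: "dir_conv ?Z ((\<lambda>\<delta>. \<delta> A) ` extension X ` \<D>) A" if A: "A \<in> Qfin X" for A
  proof (rule dir_convI)
    fix \<U> assume "openin ?Z \<U>" "A \<in> \<U>"
    then obtain U where U: "openin X U" "A \<in> box X U" "box X U \<subseteq> \<U>"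
      using Q_open_box_basis[OF c] by (metis openin_upper_powerspace)
    obtain H where H: "finite H" "H \<subseteq> topspace X" "H \<subseteq> A" "A = up X H"
      using A by (rule Qfin_E)
    have "\<exists>\<delta>\<in>\<D>. \<delta> h \<subseteq> U" if "h \<in> H" for h
    proof -
      have "h \<in> U" "h \<in> topspace X" using that H(2,3) U(2) by (auto simp: box_def)
      then have "\<exists>F\<in>(\<lambda>\<delta>. \<delta> h) ` \<D>. F \<subseteq> U"
        using D U(1) unfolding quasi_approximate_identity_def family_conv_def by blast
      then show ?thesis by blast
    qed
    then obtain \<delta> where \<delta>: "\<delta> \<in> \<D>" "\<forall>h\<in>H. \<delta> h \<subseteq> U"
      using directed_maps_finite_bound[OF dm H(1,2) U(1)] by blast
    have "extension X \<delta> A \<subseteq> U"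
      unfolding H(4) extension_up[OF q[OF \<delta>(1)] H(2)] using \<delta>(2) by (intro up_subset_open U) auto
    then have "extension X \<delta> A \<in> \<U>"
      using U(3) extension_in_Qfin[OF q[OF \<delta>(1)] A] by (auto simp: box_def)
    then show "(\<lambda>\<delta>. \<delta> A) ` extension X ` \<D> \<inter> \<U> \<noteq> {}" using \<delta>(1) by blast
  qed (simp add: that topspace_upper_powerspace)
  have dir: "directed_in ?Z ((\<lambda>\<delta>. \<delta> A) ` extension X ` \<D>)" if A: "A \<in> Qfin X" for A
    unfolding directed_in_def
  proof (intro conjI ballI)
    show "(\<lambda>\<delta>. \<delta> A) ` extension X ` \<D> \<subseteq> topspace ?Z"
      using extension_in_Qfin[OF q A] by (auto simp: topspace_upper_powerspace)
  next
    fix B C assume "B \<in> (\<lambda>\<delta>. \<delta> A) ` extension X ` \<D>" "C \<in> (\<lambda>\<delta>. \<delta> A) ` extension X ` \<D>"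
    then obtain \<delta>1 \<delta>2 where "\<delta>1 \<in> \<D>" "\<delta>2 \<in> \<D>" "B = extension X \<delta>1 A" "C = extension X \<delta>2 A"
      by blast
    then show "\<exists>K\<in>(\<lambda>\<delta>. \<delta> A) ` extension X ` \<D>. spec_le ?Z B K \<and> spec_le ?Z C K"
      using ub[of \<delta>1 \<delta>2] A by blast
  qed (use ne in blast)
  show ?thesis
    unfolding approximate_identity_def topspace_upper_powerspace
    using ne ub conv dir continuous_extension[OF c q] by simp
qed

theorem proposition5p5:
  fixes X :: "'a topology"
  assumes "d_continuous X" and "QFS_space X"
  shows "FS_space (upper_powerspace X)"
proof -
  have c: "c_space X" using assms(1) by (rule d_continuous_imp_c_space)
  then have cZ: "c_space (upper_powerspace X)" by (rule c_space_upper_powerspace)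
  obtain \<D> where D: "quasi_approximate_identity X \<D>"
    and q: "\<And>\<delta>. \<delta> \<in> \<D> \<Longrightarrow> quasi_finitely_separating X \<delta>"
    using assms(2) unfolding QFS_space_def by blast
  have "finitely_separated (upper_powerspace X)"
    unfolding finitely_separated_def
    using c_space_imp_directed_space[OF cZ] approximate_identity_extension[OF c D q]
      finitely_separating_extension[OF c q] by blast
  then show ?thesis using cZ by (simp add: FS_space_def)
qed

end
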